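(* Let $\alpha\in[0,2\pi)\setminus\{0,\pi\}$, $c_1=\cot\alpha$, $c_2=\csc\alpha$, $C_\alpha=\sqrt{\frac{1-ic_1}{2\pi}}$. Let $f\in\mathcal S_0'(\mathbb R)$ and $g\in\mathcal S_0(\mathbb R)$. Then $$e^{-ic_1\frac{\xi^2}{2}}S_g^\alpha f(x,\xi)=\sqrt\xi\,C_\alpha\,e^{ic_1\frac{x^2}{2}-ic_2x\xi}\,W^\alpha_{M_{c_2}g}f\Big(x,\frac1\xi\Big),\qquad x\in\mathbb R,\ \xi\in\mathbb R^+.$$
   Context: $\mathcal S(\mathbb R)$ is the Schwartz space; $\mathcal S_0(\mathbb R)=\{\varphi\in\mathcal S(\mathbb R): \int_{\mathbb R}x^k\varphi(x)\,dx=0\ \forall k\in\mathbb N_0\}$, with dual $\mathcal S_0'(\mathbb R)$ (Lizorkin distributions); $\mathbb R^+=(0,\infty)$. $M_ag(t)=e^{iat}g(t)$. Fractional Stockwell transform: $S_g^\alpha f(x,\xi)=|\xi|\int_{\mathbb R}f(t)\overline{g(\xi(t-x))}K_\alpha(t,\xi)\,dt$, $x\in\mathbb R$, $\xi\ne0$, where $K_\alpha(t,\xi)=C_\alpha e^{i(\frac{t^2+\xi^2}{2}c_1-t\xi c_2)}$. Fractional wavelet transform: $W_g^\alpha f(x,\xi)=\frac1{\sqrt\xi}\int_{\mathbb R}f(t)\,\overline g\big(\frac{t-x}{\xi}\big)e^{ic_1\frac{t^2-x^2}{2}}\,dt$, $x\in\mathbb R$, $\xi\in\mathbb R^+$. For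 $f\in\mathcal S_0'(\mathbb R)$ these integrals are understood as dual pairings of $f$ with the remaining function of $t$; where that function lies in $\mathcal S(\mathbb R)$ but not in $\mathcal S_0(\mathbb R)$, $f$ is extended to a continuous functional on $\mathcal S(\mathbb R)$ (Hahn–Banach; the same extension on both sides), denoted by the same letter. *)

theory Defs
  imports "HOL-Analysis.Analysis"
begin

definition nth_vderiv :: "nat \<Rightarrow> (real \<Rightarrow> complex) \<Rightarrow> real \<Rightarrow> complex" where
  "nth_vderiv n \<phi> = ((\<lambda>h x. vector_derivative h (at x)) ^^ n) \<phi>"

definition schwartz :: "(real \<Rightarrow> complex) set" where
  "schwartz = {\<phi>. (\<forall>n x. nth_vderiv n \<phi> differentiable (at x)) \<and>
     (\<forall>k n. bounded (range (\<lambda>x. of_real (x ^ k) * nth_vderiv n \<phi> x)))}"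

definition schwartz_seminorm :: "nat \<Rightarrow> nat \<Rightarrow> (real \<Rightarrow> complex) \<Rightarrow> real" where
  "schwartz_seminorm k n \<phi> = (SUP x. norm (of_real (x ^ k) * nth_vderiv n \<phi> x))"

definition schwartz_topology :: "(real \<Rightarrow> complex) topology" where
  "schwartz_topology = topology_generated_by
     {{\<phi> \<in> schwartz. schwartz_seminorm k n (\<lambda>x. \<phi> x - \<psi> x) < e} | \<psi> k n e.
        \<psi> \<in> schwartz \<and> 0 < e}"

definition schwartz0 :: "(real \<Rightarrow> complex) set" where
  "schwartz0 = {\<phi> \<in> schwartz. \<forall>k::nat. (LINT x|lborel. of_real (x ^ k) * \<phi> x) = 0}"

definition linear_functional_on ::
    "(real \<Rightarrow> complex) set \<Rightarrow> ((real \<Rightarrow> complex) \<Rightarrow> complex) \<Rightarrow> bool" where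
  "linear_functional_on V f \<longleftrightarrow>
     (\<forall>\<phi>\<in>V. \<forall>\<psi>\<in>V. f (\<lambda>t. \<phi> t + \<psi> t) = f \<phi> + f \<psi>) \<and>
     (\<forall>c. \<forall>\<phi>\<in>V. f (\<lambda>t. c * \<phi> t) = c * f \<phi>)"

text \<open>Functionals are total functions in HOL; elements of the two dual spaces below are
  unconstrained (and irrelevant) outside the respective test function space.\<close>

definition schwartz_dual :: "((real \<Rightarrow> complex) \<Rightarrow> complex) set" where
  "schwartz_dual = {f. linear_functional_on schwartz f \<and>
     continuous_map schwartz_topology euclidean f}"

definition schwartz0_dual :: "((real \<Rightarrow> complex) \<Rightarrow> complex) set" where
  "schwartz0_dual = {f. linear_functional_on schwartz0 f \<and>
     continuous_map (subtopology schwartz_topology schwartz0) euclidean f}"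

definition schwartz_extensions ::
    "((real \<Rightarrow> complex) \<Rightarrow> complex) \<Rightarrow> ((real \<Rightarrow> complex) \<Rightarrow> complex) set" where
  "schwartz_extensions f = {F \<in> schwartz_dual. \<forall>\<phi>\<in>schwartz0. F \<phi> = f \<phi>}"

definition csc :: "real \<Rightarrow> real" where
  "csc \<alpha> = 1 / sin \<alpha>"

definition frac_const :: "real \<Rightarrow> complex" where
  "frac_const \<alpha> = csqrt ((1 - \<i> * of_real (cot \<alpha>)) / of_real (2 * pi))"

definition frac_kernel :: "real \<Rightarrow> real \<Rightarrow> real \<Rightarrow> complex" where
  "frac_kernel \<alpha> t \<xi> = frac_const \<alpha> *
     exp (\<i> * of_real ((t\<^sup>2 + \<xi>\<^sup>2) / 2 * cot \<alpha> - t * \<xi> * csc \<alpha>))"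

definition modulation :: "real \<Rightarrow> (real \<Rightarrow> complex) \<Rightarrow> real \<Rightarrow> complex" where
  "modulation a g t = exp (\<i> * of_real (a * t)) * g t"

text \<open>In the two transforms the integral against \<open>f(t) dt\<close> is the bilinear dual pairing, i.e.
  the application of the functional \<open>f\<close> to the remaining function of \<open>t\<close>. That function
  is Schwartz but in general not in \<^term>\<open>schwartz0\<close>, so for a Lizorkin distribution \<open>f\<close> is to be
  an element of \<^const>\<open>schwartz_extensions\<close> of that distribution.\<close>

definition frac_stockwell ::
    "real \<Rightarrow> (real \<Rightarrow> complex) \<Rightarrow> ((real \<Rightarrow> complex) \<Rightarrow> complex) \<Rightarrow> real \<Rightarrow> real \<Rightarrow> complex" where
  "frac_stockwell \<alpha> g f x \<xi> =
     of_real \<bar>\<xi>\<bar> * f (\<lambda>t. cnj (g (\<xi> * (t - x))) * frac_kernel \<alpha> t \<xi>)"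

definition frac_wavelet ::
    "real \<Rightarrow> (real \<Rightarrow> complex) \<Rightarrow> ((real \<Rightarrow> complex) \<Rightarrow> complex) \<Rightarrow> real \<Rightarrow> real \<Rightarrow> complex" where
  "frac_wavelet \<alpha> g f x \<xi> = of_real (1 / sqrt \<xi>) *
     f (\<lambda>t. cnj (g ((t - x) / \<xi>)) * exp (\<i> * of_real (cot \<alpha> * ((t\<^sup>2 - x\<^sup>2) / 2))))"

end

(* After pulling the constant factors out of the pairing, both sides are the same functional value;
   linearity of F on the Schwartz space is only available once the test function is known to be
   Schwartz.  This closure is obtained coinductively: a family of rapidly decreasing functions that
   is closed under differentiation consists of Schwartz functions. *)

theory Submission
  imports Defs
begin

lemma nth_vderiv_0 [simp]: "nth_vderiv 0 h = h"
  by (simp add: nth_vderiv_def)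

text \<open>The definition adds each new derivative on the outside. Peeling one off on the inside
  instead lets an induction on \<open>n\<close> replace \<open>h\<close> by its derivative.\<close>

lemma nth_vderiv_Suc: "nth_vderiv (Suc n) h = nth_vderiv n (\<lambda>x. vector_derivative h (at x))"
  by (simp add: nth_vderiv_def funpow_Suc_right del: funpow.simps)

text \<open>All iterated derivatives of \<open>h\<close> stay in \<open>V\<close>, so
  differentiability and rapid decay need checking only for members of \<open>V\<close> themselves.
  In the applications, one use of the product or chain rule thus replaces a formula for the n-th
  derivative.\<close>

lemma schwartz_coinduct:
  assumes "h \<in> V"
    and deriv: "\<And>h. h \<in> V \<Longrightarrow> \<exists>h'\<in>V. \<forall>t. (h has_vector_derivative h' t) (at t)"
    and bdd: "\<And>h k. h \<in> V \<Longrightarrow> bounded (range (\<lambda>x. of_real (x ^ k) * h x))"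
  shows "h \<in> schwartz"
proof -
  have nth: "nth_vderiv n h \<in> V" if "h \<in> V" for n h
    using that
  proof (induction n arbitrary: h)
    case (Suc n)
    obtain h' where "h' \<in> V" "\<forall>t. (h has_vector_derivative h' t) (at t)"
      using deriv[OF Suc.prems] by blast
    moreover from this have "(\<lambda>x. vector_derivative h (at x)) = h'"
      by (auto intro: vector_derivative_at)
    ultimately show ?case
      using Suc.IH by (simp add: nth_vderiv_Suc)
  qed simp
  have "nth_vderiv n h differentiable (at x)" for n x
    using deriv[OF nth[OF assms(1)]] differentiableI_vector by blast
  then show ?thesis
    using bdd[OF nth[OF assms(1)]] by (simp add: schwartz_def)
qed

text \<open>The Schwartz space is itself a family of the kind required by
  \<open>schwartz_coinduct\<close>: passing to the derivative only shifts the order \<open>n\<close>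
  by one.\<close>

lemma schwartz_has_vector_derivative:
  assumes "h \<in> schwartz"
  obtains h' where "h' \<in> schwartz" "\<And>t. (h has_vector_derivative h' t) (at t)"
proof
  let ?h' = "\<lambda>x. vector_derivative h (at x)"
  have diff: "nth_vderiv n h differentiable (at x)" for n x
    using assms by (simp add: schwartz_def)
  show "?h' \<in> schwartz"
    using assms by (simp add: schwartz_def flip: nth_vderiv_Suc)
  show "(h has_vector_derivative ?h' t) (at t)" for t
    using diff[of 0] by (simp add: vector_derivative_works)
qed

lemma schwartz_bounded:
  assumes "h \<in> schwartz"
  shows "bounded (range (\<lambda>x. of_real (x ^ k) * h x))"
proof -
  have "bounded (range (\<lambda>x. of_real (x ^ k) * nth_vderiv 0 h x))"
    using assms unfolding schwartz_def by blast
  then show ?thesis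
    by simp
qed

lemma bounded_range_mult_left:
  fixes f :: "'a \<Rightarrow> 'b::real_normed_algebra"
  assumes "bounded (range f)"
  shows "bounded (range (\<lambda>x. c * f x))"
  using bounded_linear_image[OF assms bounded_linear_mult_right[of c]]
  by (simp add: image_image)

lemma schwartz_lincomb:
  assumes "f \<in> schwartz" "g \<in> schwartz"
  shows "(\<lambda>t. a * f t + b * g t) \<in> schwartz"
proof (rule schwartz_coinduct)
  let ?V = "{\<lambda>t. a * f t + b * g t | f g. f \<in> schwartz \<and> g \<in> schwartz}"
  show "(\<lambda>t. a * f t + b * g t) \<in> ?V"
    using assms by blast
  fix h assume "h \<in> ?V"
  then obtain f g where fg: "f \<in> schwartz" "g \<in> schwartz" and h: "h = (\<lambda>t. a * f t + b * g t)"
    by blast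
  obtain f' g' where fg': "f' \<in> schwartz" "g' \<in> schwartz"
    and [derivative_intros]: "\<And>t. (f has_vector_derivative f' t) (at t)"
      "\<And>t. (g has_vector_derivative g' t) (at t)"
    using fg[THEN schwartz_has_vector_derivative] by metis
  have d: "(h has_vector_derivative a * f' t + b * g' t) (at t)" for t
    unfolding h by (auto intro!: derivative_eq_intros)
  have mem: "(\<lambda>t. a * f' t + b * g' t) \<in> ?V"
    using fg' by blast
  show "\<exists>h'\<in>?V. \<forall>t. (h has_vector_derivative h' t) (at t)"
    by (intro bexI[OF _ mem] allI d)
  show "bounded (range (\<lambda>x. of_real (x ^ k) * h x))" for k
    using bounded_plus_comp[OF bounded_range_mult_left[OF schwartz_bounded[OF fg(1), of k], of a]
        bounded_range_mult_left[OF schwartz_bounded[OF fg(2), of k], of b]]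
    by (simp add: h algebra_simps)
qed

lemma schwartz_mult_ident:
  assumes "f \<in> schwartz"
  shows "(\<lambda>t. of_real t * f t) \<in> schwartz"
proof (rule schwartz_coinduct)
  \<comment> \<open>Products \<open>t * f t\<close> alone are not visibly closed under
    differentiation, since the product rule leaves an extra \<open>f\<close>. The summand
    \<open>g\<close> absorbs it.\<close>
  let ?V = "{\<lambda>t. of_real t * f t + g t | f g. f \<in> schwartz \<and> g \<in> schwartz}"
  have "(\<lambda>t. 0) \<in> schwartz"
    using schwartz_lincomb[OF assms assms, of 0 0] by simp
  with assms show "(\<lambda>t. of_real t * f t) \<in> ?V"
    by force
  fix h assume "h \<in> ?V"
  then obtain f g where fg: "f \<in> schwartz" "g \<in> schwartz" and h: "h = (\<lambda>t. of_real t * f t + g t)"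
    by blast
  obtain f' g' where fg': "f' \<in> schwartz" "g' \<in> schwartz"
    and [derivative_intros]: "\<And>t. (f has_vector_derivative f' t) (at t)"
      "\<And>t. (g has_vector_derivative g' t) (at t)"
    using fg[THEN schwartz_has_vector_derivative] by metis
  \<comment> \<open>The factors \<open>1\<close> give the new second summand \<open>f + g'\<close>
    the shape of \<open>schwartz_lincomb\<close>.\<close>
  have d: "(h has_vector_derivative of_real t * f' t + (1 * f t + 1 * g' t)) (at t)" for t
    unfolding h by (auto intro!: derivative_eq_intros)
  have mem: "(\<lambda>t. of_real t * f' t + (1 * f t + 1 * g' t)) \<in> ?V"
    using fg'(1) schwartz_lincomb[OF fg(1) fg'(2), of 1 1]
    by (intro CollectI exI[of _ f'] exI[of _ "\<lambda>t. 1 * f t + 1 * g' t"] conjI refl)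
  show "\<exists>h'\<in>?V. \<forall>t. (h has_vector_derivative h' t) (at t)"
    by (intro bexI[OF _ mem] allI d)
  show "bounded (range (\<lambda>x. of_real (x ^ k) * h x))" for k
    \<comment> \<open>The factor \<open>t\<close> raises the power by one, hence
      \<open>Suc k\<close> for \<open>f\<close> but \<open>k\<close> for \<open>g\<close>.\<close>
    using bounded_plus_comp[OF schwartz_bounded[OF fg(1), of "Suc k"] schwartz_bounded[OF fg(2), of k]]
    by (simp add: h algebra_simps)
qed

lemma schwartz_mult_affine:
  assumes "f \<in> schwartz"
  shows "(\<lambda>t. (a * of_real t + b) * f t) \<in> schwartz"
  using schwartz_lincomb[OF schwartz_mult_ident[OF assms] assms, of a b]
  by (simp add: algebra_simps)

text \<open>This supplies the decay estimate after an affine change of variable, where a power of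
  \<open>x\<close> becomes a power of an affine expression.\<close>

lemma schwartz_mult_affine_power:
  assumes "f \<in> schwartz"
  shows "(\<lambda>t. (a * of_real t + b) ^ k * f t) \<in> schwartz"
proof (induction k)
  case (Suc k)
  then show ?case
    using schwartz_mult_affine[OF Suc, of a b] by (simp add: mult.assoc)
qed (simp add: assms)

lemma schwartz_cnj:
  assumes "f \<in> schwartz"
  shows "(\<lambda>t. cnj (f t)) \<in> schwartz"
proof (rule schwartz_coinduct)
  let ?V = "{\<lambda>t. cnj (f t) | f. f \<in> schwartz}"
  show "(\<lambda>t. cnj (f t)) \<in> ?V"
    using assms by blast
  fix h assume "h \<in> ?V"
  then obtain f where f: "f \<in> schwartz" and h: "h = (\<lambda>t. cnj (f t))"
    by blast
  obtain f' where f': "f' \<in> schwartz" "\<And>t. (f has_vector_derivative f' t) (at t)"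
    using schwartz_has_vector_derivative[OF f] by blast
  have mem: "(\<lambda>t. cnj (f' t)) \<in> ?V"
    using f' by blast
  have d: "(h has_vector_derivative cnj (f' t)) (at t)" for t
    unfolding h by (intro has_vector_derivative_cnj f')
  show "\<exists>h'\<in>?V. \<forall>t. (h has_vector_derivative h' t) (at t)"
    by (intro bexI[OF _ mem] allI d)
  show "bounded (range (\<lambda>x. of_real (x ^ k) * h x))" for k
    using schwartz_bounded[OF f, of k] by (simp add: h bounded_iff norm_mult)
qed

lemma schwartz_compose_affine:
  assumes "f \<in> schwartz" and "a \<noteq> 0"
  shows "(\<lambda>t. f (a * t + b)) \<in> schwartz"
proof (rule schwartz_coinduct)
  let ?V = "{\<lambda>t. f (a * t + b) | f. f \<in> schwartz}"
  show "(\<lambda>t. f (a * t + b)) \<in> ?V"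
    using assms by blast
  fix h assume "h \<in> ?V"
  then obtain f where f: "f \<in> schwartz" and h: "h = (\<lambda>t. f (a * t + b))"
    by blast
  obtain f' where f': "f' \<in> schwartz" "\<And>t. (f has_vector_derivative f' t) (at t)"
    using schwartz_has_vector_derivative[OF f] by blast
  have "(f \<circ> (\<lambda>t. a * t + b) has_vector_derivative a *\<^sub>R f' (a * t + b)) (at t)" for t
    by (rule vector_diff_chain_at)
      (auto intro!: derivative_eq_intros f' simp flip: has_real_derivative_iff_has_vector_derivative)
  \<comment> \<open>The vanishing summand turns the multiple by the chain rule factor
    \<open>a\<close> into an instance of \<open>schwartz_lincomb\<close>.\<close>
  then have d: "(h has_vector_derivative of_real a * f' (a * t + b) + 0 * f' (a * t + b)) (at t)" for t
    by (simp add: h o_def scaleR_conv_of_real)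
  have mem: "(\<lambda>t. of_real a * f' (a * t + b) + 0 * f' (a * t + b)) \<in> ?V"
    using schwartz_lincomb[OF f'(1) f'(1), of "of_real a" 0]
    by (intro CollectI exI[of _ "\<lambda>t. of_real a * f' t + 0 * f' t"] conjI refl)
  show "\<exists>h'\<in>?V. \<forall>t. (h has_vector_derivative h' t) (at t)"
    by (intro bexI[OF _ mem] allI d)
  show "bounded (range (\<lambda>x. of_real (x ^ k) * h x))" for k
  proof -
    \<comment> \<open>Substituting \<open>y = a * x + b\<close>, that is
      \<open>x = (y - b) / a\<close>, turns \<open>x ^ k * h x\<close> into \<open>H y\<close>; a
      bound for \<open>H\<close> on the whole line then suffices.\<close>
    define H where "H = (\<lambda>y. (of_real (1 / a) * of_real y + of_real (- b / a)) ^ k * f y)"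
    have "H \<in> schwartz"
      unfolding H_def by (rule schwartz_mult_affine_power[OF f])
    then have "bounded (range H)"
      using schwartz_bounded[of H 0] by simp
    moreover have "of_real (x ^ k) * h x = H (a * x + b)" for x
    proof -
      have "x = 1 / a * (a * x + b) + - b / a"
        using assms(2) by (simp add: field_simps)
      then have "of_real x = of_real (1 / a) * of_real (a * x + b) + (of_real (- b / a) :: complex)"
        by (metis of_real_add of_real_mult)
      then show ?thesis
        by (simp only: H_def h of_real_power)
    qed
    ultimately show ?thesis
      by (auto intro: bounded_subset)
  qed
qed

text \<open>Differentiating chirp times \<open>f\<close> gives the same chirp times
  \<open>f' + \<i> * (2 * p * t + q) * f\<close>, which is again a Schwartz factor. The chirp has
  modulus 1, so decay is inherited from \<open>f\<close>.\<close>

lemma schwartz_mult_chirp: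
  assumes "f \<in> schwartz"
  shows "(\<lambda>t. exp (\<i> * of_real (p * t\<^sup>2 + q * t + r)) * f t) \<in> schwartz"
proof (rule schwartz_coinduct)
  let ?e = "\<lambda>t. exp (\<i> * of_real (p * t\<^sup>2 + q * t + r))"
  let ?V = "{\<lambda>t. ?e t * f t | f. f \<in> schwartz}"
  show "(\<lambda>t. ?e t * f t) \<in> ?V"
    using assms by blast
  fix h assume "h \<in> ?V"
  then obtain f where f: "f \<in> schwartz" and h: "h = (\<lambda>t. ?e t * f t)"
    by blast
  obtain f' where f': "f' \<in> schwartz"
    "\<And>t. (f has_vector_derivative f' t) (at t)"
    using schwartz_has_vector_derivative[OF f] by blast
  define F where "F = (\<lambda>t. 1 * f' t + 1 * ((2 * \<i> * of_real p * of_real t + \<i> * of_real q) * f t))"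
  have "F \<in> schwartz"
    unfolding F_def by (intro schwartz_lincomb schwartz_mult_affine f f')
  then have mem: "(\<lambda>t. ?e t * F t) \<in> ?V"
    by blast
  have d: "(h has_vector_derivative ?e t * F t) (at t)" for t
  proof -
    have "((\<lambda>t. p * t\<^sup>2 + q * t + r) has_real_derivative 2 * p * t + q) (at t)"
      by (auto intro!: derivative_eq_intros)
    then have "((\<lambda>t. \<i> * of_real (p * t\<^sup>2 + q * t + r)) has_vector_derivative
        \<i> * of_real (2 * p * t + q)) (at t)"
      by (intro has_vector_derivative_mult_right has_vector_derivative_of_real)
    then have "(?e has_vector_derivative (\<i> * of_real (2 * p * t + q)) * ?e t) (at t)"
      using field_vector_diff_chain_at[OF _ DERIV_exp] by (fastforce simp: o_def)
    then have "(h has_vector_derivative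
        ?e t * f' t + (\<i> * of_real (2 * p * t + q)) * ?e t * f t) (at t)"
      unfolding h by (rule has_vector_derivative_mult) (rule f'(2))
    then show ?thesis
      by (simp add: F_def algebra_simps)
  qed
  show "\<exists>h'\<in>?V. \<forall>t. (h has_vector_derivative h' t) (at t)"
    by (intro bexI[OF _ mem] allI d)
  show "bounded (range (\<lambda>x. of_real (x ^ k) * h x))" for k
    using schwartz_bounded[OF f, of k] by (simp add: h bounded_iff norm_mult)
qed

theorem proposition4p6:
  fixes \<alpha> x \<xi> :: real
    and f F :: "(real \<Rightarrow> complex) \<Rightarrow> complex"
    and g :: "real \<Rightarrow> complex"
  assumes "\<alpha> \<in> {0..<2 * pi} - {0, pi}"
    and "f \<in> schwartz0_dual"
    and "F \<in> schwartz_extensions f"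
    and "g \<in> schwartz0"
    and "\<xi> \<in> {0<..}"
  shows "exp (- \<i> * of_real (cot \<alpha> * (\<xi>\<^sup>2 / 2))) * frac_stockwell \<alpha> g F x \<xi> =
    of_real (sqrt \<xi>) * frac_const \<alpha> *
    exp (\<i> * of_real (cot \<alpha> * (x\<^sup>2 / 2)) - \<i> * of_real (csc \<alpha> * x * \<xi>)) *
    frac_wavelet \<alpha> (modulation (csc \<alpha>) g) F x (1 / \<xi>)"
proof -
  have \<xi>: "\<xi> > 0"
    using assms by simp
  have scale: "F (\<lambda>t. c * \<phi> t) = c * F \<phi>" if "\<phi> \<in> schwartz" for c \<phi>
    using assms(3) that
    by (simp add: schwartz_extensions_def schwartz_dual_def linear_functional_on_def)
  \<comment> \<open>The test function common to both transforms, keeping only the factors that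
    depend on \<open>t\<close>. The form of the exponent and of the argument of \<open>g\<close>
    matches the chirp and affine closure lemmas.\<close>
  define \<psi> where "\<psi> = (\<lambda>t. exp (\<i> * of_real (cot \<alpha> / 2 * t\<^sup>2 + (- csc \<alpha> * \<xi>) * t + 0)) *
    cnj (g (\<xi> * t + - \<xi> * x)))"
  have "g \<in> schwartz"
    using assms by (simp add: schwartz0_def)
  then have \<psi>: "\<psi> \<in> schwartz"
    unfolding \<psi>_def using \<xi>
    by (intro schwartz_mult_chirp schwartz_compose_affine[of "\<lambda>t. cnj (g t)"] schwartz_cnj) auto
  have exp_sub: "exp (a - b) = exp a * exp (- b)" for a b :: complex
    by (simp add: mult_exp_exp)
  \<comment> \<open>\<open>c\<close> and \<open>d\<close> collect the factors free of
    \<open>t\<close>. In \<open>d\<close>, the term with \<open>csc \<alpha> * x * \<xi>\<close>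
    comes from the conjugated modulation evaluated at \<open>\<xi> * (t - x)\<close>.\<close>
  define c where "c = frac_const \<alpha> * exp (\<i> * of_real (cot \<alpha> * (\<xi>\<^sup>2 / 2)))"
  define d where "d = exp (\<i> * of_real (csc \<alpha> * x * \<xi>) - \<i> * of_real (cot \<alpha> * (x\<^sup>2 / 2)))"
  have "(\<lambda>t. cnj (g (\<xi> * (t - x))) * frac_kernel \<alpha> t \<xi>) = (\<lambda>t. c * \<psi> t)"
    by (rule ext) (simp add: frac_kernel_def c_def \<psi>_def algebra_simps
        add_divide_distrib diff_divide_distrib exp_sub flip: mult_exp_exp)
  then have S: "frac_stockwell \<alpha> g F x \<xi> = of_real \<xi> * (c * F \<psi>)"
    using \<xi> scale[OF \<psi>] by (simp add: frac_stockwell_def)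
  have "(\<lambda>t. cnj (modulation (csc \<alpha>) g ((t - x) / (1 / \<xi>))) *
      exp (\<i> * of_real (cot \<alpha> * ((t\<^sup>2 - x\<^sup>2) / 2)))) = (\<lambda>t. d * \<psi> t)"
    by (rule ext) (simp add: modulation_def d_def \<psi>_def exp_cnj algebra_simps
        add_divide_distrib diff_divide_distrib exp_sub flip: mult_exp_exp)
  \<comment> \<open>At scale \<open>1 / \<xi>\<close> the normalisation
    \<open>1 / sqrt (1 / \<xi>)\<close> equals \<open>sqrt \<xi>\<close>; with the explicit
    \<open>sqrt \<xi>\<close> of the claim it makes up the factor \<open>\<xi>\<close> of the
    Stockwell transform.\<close>
  then have W: "frac_wavelet \<alpha> (modulation (csc \<alpha>) g) F x (1 / \<xi>) = of_real (sqrt \<xi>) * (d * F \<psi>)"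
    using scale[OF \<psi>] by (simp add: frac_wavelet_def real_sqrt_divide)
  have c: "exp (- \<i> * of_real (cot \<alpha> * (\<xi>\<^sup>2 / 2))) * c = frac_const \<alpha>"
    by (simp add: c_def mult_exp_exp)
  have d: "exp (\<i> * of_real (cot \<alpha> * (x\<^sup>2 / 2)) - \<i> * of_real (csc \<alpha> * x * \<xi>)) * d = 1"
    by (simp add: d_def mult_exp_exp)
  have s: "of_real (sqrt \<xi>) * of_real (sqrt \<xi>) = (of_real \<xi> :: complex)"
    using \<xi> by (simp flip: of_real_mult)
  have "exp (- \<i> * of_real (cot \<alpha> * (\<xi>\<^sup>2 / 2))) * frac_stockwell \<alpha> g F x \<xi> =
      of_real \<xi> * frac_const \<alpha> * F \<psi>"
    unfolding S by (simp add: mult_ac flip: c)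
  also have "\<dots> = (of_real (sqrt \<xi>) * of_real (sqrt \<xi>)) * frac_const \<alpha> *
      (exp (\<i> * of_real (cot \<alpha> * (x\<^sup>2 / 2)) - \<i> * of_real (csc \<alpha> * x * \<xi>)) * d) * F \<psi>"
    by (simp only: s d mult_1_right)
  also have "\<dots> = of_real (sqrt \<xi>) * frac_const \<alpha> *
      exp (\<i> * of_real (cot \<alpha> * (x\<^sup>2 / 2)) - \<i> * of_real (csc \<alpha> * x * \<xi>)) *
      frac_wavelet \<alpha> (modulation (csc \<alpha>) g) F x (1 / \<xi>)"
    unfolding W by (simp only: mult_ac)
  finally show ?thesis .
qed

end
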